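(* Let $m,n$ be positive integers, let $c\in\mathbb{C}\setminus\{0\}$, let $A,B$ be non-zero complex constants, and let $R(z)$ be a non-zero polynomial. If the delay-differential equation $$f^2(z)+R^2(z)\bigl(Af^{(m)}(z+c)+Bf^{(n)}(z)\bigr)^2=1$$ has a transcendental entire solution $f$ of finite order, then $R(z)$ reduces to a constant, denoted $R$, and $f$ takes the form $$f(z)=\frac{e^{az+b}+e^{-(az+b)}}{2}$$ for some $a,b\in\mathbb{C}$, such that: (I) when $m$ and $n$ are both even, $a^{m-n}\neq\pm\frac{B}{A}$ (neither sign), $R^2=\dfrac{1}{a^{2m}A^2-a^{2n}B^2}$, and $e^{ac}=\dfrac{-a^nB\pm\sqrt{(a^nB)^2-(a^mA)^2}}{a^mA}$ (for one of the two choices of sign); also $e^{ac}\notin\left\{1,-1,-\dfrac{a^mA}{a^nB},-\dfrac{a^nB}{a^mA}\right\}$; (II) when $m$ and $n$ are both odd, $e^{ac}=\pm1$, $a^{m-n}\neq\mp\frac{B}{A}$ and $R=\dfrac{-i}{a^nB\pm a^mA}$, where either all upper signs or all lower signs are taken; (III) when $m$ is even and $n$ is odd, $e^{ac}=\pm i$, $a^{m-n}\neq\pm i\frac{B}{A}$ and $R=\dfrac{-i}{a^nB\pm ia^mA}$, where either all upper signs or all lower signs are taken; (IV) when $n$ is even and $m$ is odd, $a^{m-n}\neq\pm i\frac{B}{A}$ (neither sign), $R^2=-\dfrac{1}{a^{2n}B^2+a^{2m}A^2}$, and $e^{ac}=\dfrac{-a^nB\pm\sqrt{(a^nB)^2+(a^mA)^2}}{a^mA}$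 (for one of the two choices of sign); also $e^{ac}\notin\left\{1,-1,\dfrac{a^mA}{a^nB},-\dfrac{a^nB}{a^mA}\right\}$.
   Context: The order of a meromorphic function $f$ on $\mathbb{C}$ is $\rho(f)=\limsup_{r\to\infty}\frac{\log T(r,f)}{\log r}$, where $T(r,f)$ is the Nevanlinna characteristic; finite order means $\rho(f)<\infty$. $f^{(m)}(z+c)$ denotes the $m$-th derivative of $f$ evaluated at $z+c$. *)

theory Defs
  imports "HOL-Complex_Analysis.Complex_Analysis"
begin

section \<open>Nevanlinna characteristic and order of a meromorphic function on the plane\<close>

definition log_plus :: "real \<Rightarrow> real" where
  "log_plus x = max 0 (ln x)"

text \<open>The value that HOL assigns to \<open>f\<close> at a pole is irrelevant below: every circle contains
  only finitely many poles.  Moreover \<open>log_plus 0 = 0\<close> as it should, since \<open>ln 0 = 0\<close> in HOL.\<close>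

definition proximity_fun :: "(complex \<Rightarrow> complex) \<Rightarrow> real \<Rightarrow> real" where
  "proximity_fun f r =
     1 / (2 * pi) * integral {0..2 * pi} (\<lambda>\<theta>. log_plus (norm (f (of_real r * cis \<theta>))))"

text \<open>The number of poles in the closed disc of radius \<open>t\<close>, counted with multiplicity
  (the order of a pole \<open>z\<close> is \<open>- zorder f z\<close>).\<close>

definition pole_count :: "(complex \<Rightarrow> complex) \<Rightarrow> real \<Rightarrow> nat" where
  "pole_count f t = (\<Sum>z\<in>{z. norm z \<le> t \<and> is_pole f z}. nat (- zorder f z))"

definition integrated_pole_count :: "(complex \<Rightarrow> complex) \<Rightarrow> real \<Rightarrow> real" where
  "integrated_pole_count f r =
     integral {0..r} (\<lambda>t. (real (pole_count f t) - real (pole_count f 0)) / t)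
       + real (pole_count f 0) * ln r"

definition nevanlinna_char :: "(complex \<Rightarrow> complex) \<Rightarrow> real \<Rightarrow> real" where
  "nevanlinna_char f r = proximity_fun f r + integrated_pole_count f r"

definition growth_order :: "(complex \<Rightarrow> complex) \<Rightarrow> ereal" where
  "growth_order f = Limsup at_top (\<lambda>r::real. ereal (ln (nevanlinna_char f r) / ln r))"

definition transcendental_entire :: "(complex \<Rightarrow> complex) \<Rightarrow> bool" where
  "transcendental_entire f \<longleftrightarrow>
     f holomorphic_on UNIV \<and> \<not> (\<exists>p :: complex poly. \<forall>z. f z = poly p z)"

end

theory Submission
  imports Defs
begin

text \<open>
  Put \<open>g z = R(z) (A f\<^sup>(\<^sup>m\<^sup>)(z + c) + B f\<^sup>(\<^sup>n\<^sup>)(z))\<close>.  The equation reads \<open>(f + \<i> g) (f - \<i> g) = 1\<close>, so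
  \<open>f + \<i> g\<close> is entire without zeros, hence \<open>f + \<i> g = exp P\<close> and \<open>f - \<i> g = exp (- P)\<close> with \<open>P\<close>
  entire; thus \<open>f = (exp P + exp (- P)) / 2\<close>.

  Finite order makes \<open>P\<close> a polynomial.  No maximum modulus estimate is needed, because
  \<open>\<bar>Re P\<bar> \<le> log\<^sup>+ \<bar>f\<bar> + ln 4\<close> holds pointwise (lemma \<open>abs_Re_le_log_plus_cosh\<close>): the mean of
  \<open>\<bar>Re P\<bar>\<close> over the circle of radius \<open>r\<close> is at most \<open>T(r, f) + ln 4\<close>, which grows at most like a
  power of \<open>r\<close>, and twice that mean bounds \<open>\<bar>a\<^sub>k\<bar> r\<^sup>k\<close> for every Taylor coefficient \<open>a\<^sub>k\<close> of \<open>P\<close> with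
  \<open>k \<ge> 1\<close>, so \<open>a\<^sub>k = 0\<close> for large \<open>k\<close> (lemma \<open>higher_deriv_le_integral_abs_Re\<close>).

  Substituting \<open>f\<close> back turns the equation into a relation, with polynomial coefficients, between
  the exponentials of \<open>P(z)\<close>, \<open>- P(z)\<close>, \<open>P(z + c)\<close> and \<open>- P(z + c)\<close>.  Exponentials of polynomials
  whose differences are not constant are linearly independent over the polynomials (lemma
  \<open>exp_poly_linear_independent\<close>, a case of Borel's theorem).  If \<open>degree P \<ge> 2\<close>, this applies to
  all four, and the coefficient of \<open>exp (P(z + c))\<close> would have to vanish, which it does not.
  Hence \<open>P(z) = a z + b\<close> with \<open>a \<noteq> 0\<close>, and independence of \<open>exp P\<close> and \<open>exp (- P)\<close> gives
  \<open>R (a\<^sup>m A w + a\<^sup>n B) = - \<i>\<close> and \<open>R ((- a)\<^sup>m A / w + (- a)\<^sup>n B) = \<i>\<close> with \<open>w = exp (a c)\<close>.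
  So \<open>R\<close> is constant, and the four cases are elementary algebra.
\<close>


section \<open>Linear independence of exponentials of polynomials\<close>

text \<open>The operator \<open>p \<mapsto> p' + S' p\<close>, which is differentiation of \<open>p exp S\<close> read off on the
  polynomial factor.\<close>

definition twisted_deriv :: "complex poly \<Rightarrow> complex poly \<Rightarrow> complex poly" where
  "twisted_deriv S p = pderiv p + pderiv S * p"

lemma DERIV_poly_times_exp_poly:
  "((\<lambda>z. poly p z * exp (poly S z)) has_field_derivative
      poly (twisted_deriv S p) z * exp (poly S z)) (at z)"
  unfolding twisted_deriv_def
  by (auto intro!: derivative_eq_intros simp: algebra_simps)

text \<open>If \<open>S\<close> is not constant, \<open>S' p\<close> has at least the degree of \<open>p\<close>, hence is not cancelled
  by \<open>p'\<close>.\<close>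

lemma twisted_deriv_eq_0_iff:
  assumes "pderiv S \<noteq> 0"
  shows "twisted_deriv S p = 0 \<longleftrightarrow> p = 0"
proof
  assume eq: "twisted_deriv S p = 0"
  show "p = 0"
  proof (rule ccontr)
    assume "p \<noteq> 0"
    have "pderiv p = - (pderiv S * p)"
      using eq by (simp add: twisted_deriv_def add_eq_0_iff2)
    hence "degree (pderiv p) = degree (pderiv S) + degree p" "pderiv p \<noteq> 0"
      using assms \<open>p \<noteq> 0\<close> by (simp_all add: degree_mult_eq)
    thus False
      by (auto simp: degree_pderiv pderiv_eq_0_iff)
  qed
qed (simp add: twisted_deriv_def pderiv_0)

lemma funpow_twisted_deriv_eq_0_iff:
  assumes "pderiv S \<noteq> 0"
  shows "(twisted_deriv S ^^ k) p = 0 \<longleftrightarrow> p = 0"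
  by (induction k) (simp_all add: twisted_deriv_eq_0_iff assms)

lemma funpow_twisted_deriv_const:
  assumes "pderiv S = [:a:]"
  shows "(twisted_deriv S ^^ k) 1 = [:a ^ k:]"
  by (induction k) (simp_all add: twisted_deriv_def assms one_pCons pderiv_pCons)

lemma pderiv_funpow_eq_0:
  fixes p :: "complex poly"
  shows "(pderiv ^^ Suc (degree p)) p = 0"
proof -
  have "degree p < k \<Longrightarrow> (pderiv ^^ k) p = 0" for k
  proof (induction k arbitrary: p)
    case (Suc k)
    show ?case
    proof (cases "degree p = 0")
      case True
      hence "pderiv p = 0" by (simp add: pderiv_eq_0_iff)
      moreover have "(pderiv ^^ k) 0 = (0 :: complex poly)"
        by (induction k) (simp_all add: pderiv_0)
      ultimately show ?thesis by (simp add: funpow_Suc_right del: funpow.simps)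
    next
      case False
      hence "degree (pderiv p) < k" using Suc.prems by (simp add: degree_pderiv)
      from Suc.IH[OF this] show ?thesis by (simp add: funpow_Suc_right del: funpow.simps)
    qed
  qed simp
  thus ?thesis by blast
qed

text \<open>Induction on the number of exponentials: divide by one of them, and differentiate until its
  polynomial coefficient disappears.  The other coefficients undergo injective operators.\<close>

lemma exp_poly_linear_independent:
  fixes p Q :: "'i \<Rightarrow> complex poly"
  assumes "finite I"
    and "\<And>i j. i \<in> I \<Longrightarrow> j \<in> I \<Longrightarrow> i \<noteq> j \<Longrightarrow> pderiv (Q i - Q j) \<noteq> 0"
    and "\<And>z. (\<Sum>i\<in>I. poly (p i) z * exp (poly (Q i) z)) = 0"
    and "i \<in> I"
  shows "p i = 0"
  using assms
proof (induction I arbitrary: p Q i rule: finite_induct)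
  case (insert k I)
  define S where "S i = Q i - Q k" for i
  have sum0: "(\<Sum>i\<in>I. poly (p i) z * exp (poly (S i) z)) + poly (p k) z = 0" for z
  proof -
    have "0 = (\<Sum>i\<in>insert k I. poly (p i) z * exp (poly (Q i) z)) * exp (- poly (Q k) z)"
      by (simp only: insert.prems(2) mult_zero_left)
    also have "\<dots> = (\<Sum>i\<in>insert k I. poly (p i) z * exp (poly (S i) z))"
      unfolding S_def sum_distrib_right
      by (intro sum.cong) (auto simp: exp_diff exp_minus divide_inverse)
    finally show ?thesis
      using insert.hyps by (subst add.commute) (simp add: S_def)
  qed
  have derivs: "(\<Sum>i\<in>I. poly ((twisted_deriv (S i) ^^ N) (p i)) z * exp (poly (S i) z))
      + poly ((pderiv ^^ N) (p k)) z = 0" for N z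
  proof (induction N arbitrary: z)
    case (Suc N)
    let ?F = "\<lambda>z. (\<Sum>i\<in>I. poly ((twisted_deriv (S i) ^^ N) (p i)) z * exp (poly (S i) z))
      + poly ((pderiv ^^ N) (p k)) z"
    have "(?F has_field_derivative
        (\<Sum>i\<in>I. poly ((twisted_deriv (S i) ^^ Suc N) (p i)) z * exp (poly (S i) z))
        + poly ((pderiv ^^ Suc N) (p k)) z) (at z)"
      unfolding funpow.simps o_apply
      by (intro DERIV_add DERIV_sum DERIV_poly_times_exp_poly poly_DERIV)
    moreover have "?F = (\<lambda>_. 0)" by (rule ext) (rule Suc.IH)
    ultimately have "((\<lambda>_. 0) has_field_derivative
        (\<Sum>i\<in>I. poly ((twisted_deriv (S i) ^^ Suc N) (p i)) z * exp (poly (S i) z))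
        + poly ((pderiv ^^ Suc N) (p k)) z) (at z)" by (simp only:)
    thus ?case by (rule DERIV_unique) simp
  qed (use sum0 in simp)
  \<comment> \<open>This many derivatives annihilate \<open>p k\<close>.\<close>
  define N where "N = Suc (degree (p k))"
  have p0: "p i = 0" if "i \<in> I" for i
  proof -
    have "(twisted_deriv (S i) ^^ N) (p i) = 0"
    proof (rule insert.IH[of S "\<lambda>i. (twisted_deriv (S i) ^^ N) (p i)"])
      show "pderiv (S i - S j) \<noteq> 0" if "i \<in> I" "j \<in> I" "i \<noteq> j" for i j
        using insert.prems(1)[of i j] that by (simp add: S_def)
      show "(\<Sum>i\<in>I. poly ((twisted_deriv (S i) ^^ N) (p i)) z * exp (poly (S i) z)) = 0" for z
        using derivs[of N z] by (simp add: N_def pderiv_funpow_eq_0 del: funpow.simps)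
    qed (use that in auto)
    moreover have "pderiv (S i) \<noteq> 0"
      using insert.prems(1)[of i k] that insert.hyps by (auto simp: S_def)
    ultimately show ?thesis by (simp add: funpow_twisted_deriv_eq_0_iff)
  qed
  have "poly (p k) z = 0" for z
    using sum0[of z] p0 by simp
  hence "p k = 0" using poly_all_0_iff_0 by blast
  thus ?case using p0 insert.prems(3) by blast
qed simp

lemma poly_periodic_imp_degree_0:
  fixes p :: "complex poly"
  assumes "p \<circ>\<^sub>p [:c, 1:] = p" "c \<noteq> 0"
  shows "degree p = 0"
proof -
  have step: "poly p (z + c) = poly p z" for z
    using arg_cong[OF assms(1), of "\<lambda>q. poly q z"] by (simp add: poly_pcompose add.commute)
  have "poly p (of_nat k * c) = poly p 0" for k
  proof (induction k)
    case (Suc k)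
    thus ?case using step[of "of_nat k * c"] by (simp add: algebra_simps)
  qed simp
  hence "range (\<lambda>k. of_nat k * c) \<subseteq> {z. poly (p - [:poly p 0:]) z = 0}" by auto
  moreover have "infinite (range (\<lambda>k. of_nat k * c))"
    using assms(2) by (intro range_inj_infinite) (auto simp: inj_on_def)
  ultimately have "p - [:poly p 0:] = 0"
    using poly_roots_finite finite_subset by blast
  hence "p = [:poly p 0:]" by simp
  thus ?thesis by (metis degree_pCons_0)
qed


section \<open>Entire functions whose real part has moderate mean\<close>

text \<open>For \<open>k \<ge> 1\<close> the function \<open>P\<close> and the conjugate of \<open>P\<close> have on the circle of radius \<open>r\<close> the
  \<open>k\<close>-th Fourier coefficients \<open>a\<^sub>k r\<^sup>k\<close> and \<open>0\<close>, so \<open>2 Re P\<close> has \<open>k\<close>-th Fourier coefficient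
  \<open>a\<^sub>k r\<^sup>k\<close>.\<close>

lemma higher_deriv_le_integral_abs_Re:
  assumes holo: "P holomorphic_on UNIV" and "k > 0" "r > 0"
  shows "norm ((deriv ^^ k) P 0 / fact k) * r ^ k * pi
          \<le> integral {0..2 * pi} (\<lambda>\<theta>. \<bar>Re (P (of_real r * cis \<theta>))\<bar>)"
proof -
  define a where "a = (deriv ^^ k) P 0 / fact k"
  have cont: "continuous_on A P" for A
    using holo holomorphic_on_imp_continuous_on continuous_on_subset by blast
  have "((\<lambda>u. P u / (u - 0) ^ Suc k) has_contour_integral
      (2 * pi * \<i>) / fact k * (deriv ^^ k) P 0) (circlepath 0 r)"
    using \<open>r > 0\<close> holo
    by (intro Cauchy_has_contour_integral_higher_derivative_circlepath cont)
       (auto intro: holomorphic_on_subset)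
  hence "((\<lambda>t. P (of_real r * cis t) / (of_real r * cis t) ^ Suc k * r * \<i> * cis t)
      has_integral 2 * pi * \<i> * a) {0..2 * pi}"
    unfolding circlepath_def
    by (subst (asm) has_contour_integral_part_circlepath_iff) (simp_all add: a_def)
  from has_integral_mult_right[OF this, of "of_real r ^ k / \<i>"]
  have "((\<lambda>t. of_real r ^ k / \<i> * (P (of_real r * cis t) / (of_real r * cis t) ^ Suc k * r * \<i> * cis t))
      has_integral 2 * pi * a * of_real r ^ k) {0..2 * pi}"
    by (simp add: mult_ac)
  also have "(\<lambda>t. of_real r ^ k / \<i> * (P (of_real r * cis t) / (of_real r * cis t) ^ Suc k * r * \<i> * cis t))
      = (\<lambda>t. P (of_real r * cis t) * cis (- (real k * t)))"
  proof
    fix t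
    have "cis (- (real k * t)) = inverse (cis t ^ k)"
      by (simp add: Complex.DeMoivre cis_inverse)
    thus "of_real r ^ k / \<i> * (P (of_real r * cis t) / (of_real r * cis t) ^ Suc k * r * \<i> * cis t)
      = P (of_real r * cis t) * cis (- (real k * t))"
      using \<open>r > 0\<close> by (simp add: field_simps power_mult_distrib)
  qed
  finally have int1: "((\<lambda>t. P (of_real r * cis t) * cis (- (real k * t)))
      has_integral 2 * pi * a * of_real r ^ k) {0..2 * pi}" .

  have "((\<lambda>u. P u * u ^ (k - 1)) has_contour_integral 0) (circlepath 0 r)"
    by (rule Cauchy_theorem_convex_simple[of _ UNIV])
       (use holo in \<open>auto intro!: holomorphic_intros\<close>)
  hence "((\<lambda>t. P (of_real r * cis t) * (of_real r * cis t) ^ (k - 1) * r * \<i> * cis t)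
      has_integral 0) {0..2 * pi}"
    unfolding circlepath_def
    by (subst (asm) has_contour_integral_part_circlepath_iff) simp_all
  from has_integral_mult_right[OF this, of "1 / (\<i> * of_real r ^ k)"]
  have "((\<lambda>t. 1 / (\<i> * of_real r ^ k) * (P (of_real r * cis t) * (of_real r * cis t) ^ (k - 1) * r * \<i> * cis t))
      has_integral 0) {0..2 * pi}" by simp
  also have "(\<lambda>t. 1 / (\<i> * of_real r ^ k) * (P (of_real r * cis t) * (of_real r * cis t) ^ (k - 1) * r * \<i> * cis t))
      = (\<lambda>t. P (of_real r * cis t) * cis (real k * t))"
  proof
    fix t
    obtain j where k: "k = Suc j" using \<open>k > 0\<close> gr0_implies_Suc by blast
    have "cis (real k * t) = cis t * cis t ^ j"
      by (simp add: k Complex.DeMoivre cis_mult algebra_simps)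
    thus "1 / (\<i> * of_real r ^ k) * (P (of_real r * cis t) * (of_real r * cis t) ^ (k - 1) * r * \<i> * cis t)
      = P (of_real r * cis t) * cis (real k * t)"
      using \<open>r > 0\<close> by (simp add: k power_mult_distrib mult_ac)
  qed
  finally have "((\<lambda>t. P (of_real r * cis t) * cis (real k * t)) has_integral 0) {0..2 * pi}" .
  from iffD2[OF has_integral_cnj this]
  have int_cnj: "((\<lambda>t. cnj (P (of_real r * cis t) * cis (real k * t))) has_integral cnj 0) {0..2 * pi}"
    by (simp only: o_def)
  have add_cnj: "P (of_real r * cis t) * cis (- (real k * t))
      + cnj (P (of_real r * cis t) * cis (real k * t))
      = 2 * of_real (Re (P (of_real r * cis t))) * cis (- (real k * t))" for t
    unfolding complex_cnj_mult cis_cnj distrib_right[symmetric] complex_add_cnj by simp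
  from has_integral_add[OF int1 int_cnj]
  have "((\<lambda>t. 2 * of_real (Re (P (of_real r * cis t))) * cis (- (real k * t)))
      has_integral 2 * pi * a * of_real r ^ k) {0..2 * pi}"
    unfolding add_cnj by simp
  from has_integral_mult_right[OF this, of "1 / 2"]
  have int2: "((\<lambda>t. of_real (Re (P (of_real r * cis t))) * cis (- (real k * t)))
      has_integral pi * a * of_real r ^ k) {0..2 * pi}"
    by (simp add: mult.assoc)
  have "norm (pi * a * of_real r ^ k)
      \<le> integral {0..2 * pi} (\<lambda>t. \<bar>Re (P (of_real r * cis t))\<bar>)"
    unfolding integral_unique[OF int2, symmetric]
  proof (rule integral_norm_bound_integral)
    show "(\<lambda>t. \<bar>Re (P (of_real r * cis t))\<bar>) integrable_on {0..2 * pi}"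
      by (intro integrable_continuous_real continuous_intros
            continuous_on_compose2[OF cont[of UNIV]]) auto
  qed (use int2 in \<open>auto simp: norm_mult\<close>)
  moreover have "norm (pi * a * of_real r ^ k) = norm a * r ^ k * pi"
    using \<open>r > 0\<close> by (simp add: norm_mult norm_power)
  ultimately show ?thesis by (simp only: a_def)
qed

lemma entire_eq_poly_if_mean_abs_Re_le_powr:
  assumes holo: "P holomorphic_on UNIV"
    and bound: "\<forall>\<^sub>F r in at_top. integral {0..2 * pi} (\<lambda>\<theta>. \<bar>Re (P (of_real r * cis \<theta>))\<bar>)
                  \<le> C * r powr K + D"
  shows "\<exists>p. \<forall>z. P z = poly p z"
proof -
  define a where "a k = (deriv ^^ k) P 0 / fact k" for k
  define N where "N = Suc (nat \<lceil>K\<rceil>)"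
  have N: "real N > K" "N > 0" unfolding N_def by linarith+
  have a0: "a k = 0" if "k \<ge> N" for k
  proof -
    have "\<forall>\<^sub>F r in at_top. norm (a k) * pi \<le> (C * r powr K + D) / r powr k"
      using bound eventually_gt_at_top[of 0]
    proof eventually_elim
      case (elim r)
      have "norm (a k) * r ^ k * pi \<le> C * r powr K + D"
        using higher_deriv_le_integral_abs_Re[OF holo, of k r] elim that N
        by (simp add: a_def)
      thus ?case using elim by (simp add: powr_realpow field_simps)
    qed
    moreover have "((\<lambda>r. (C * r powr K + D) / r powr k) \<longlongrightarrow> 0) at_top"
    proof -
      have "((\<lambda>r. C * r powr (K - real k) + D * r powr (- real k)) \<longlongrightarrow> C * 0 + D * 0) at_top"
        using N that by (intro tendsto_intros tendsto_neg_powr filterlim_ident) auto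
      moreover have "C * r powr (K - real k) + D * r powr (- real k) = (C * r powr K + D) / r powr k" for r
        by (simp add: powr_diff powr_minus field_simps add_divide_distrib)
      ultimately show ?thesis by simp
    qed
    ultimately have "norm (a k) * pi \<le> 0"
      by (intro tendsto_lowerbound[where F = "at_top :: real filter"]) auto
    thus ?thesis using pi_gt_zero by (simp add: mult_le_0_iff not_le)
  qed
  have "P z = poly (\<Sum>k<N. monom (a k) k) z" for z
  proof -
    have "(\<lambda>k. (deriv ^^ k) P 0 / fact k * (z - 0) ^ k) sums P z"
      by (rule holomorphic_power_series[of _ _ "norm z + 1"])
         (use holo in \<open>auto intro: holomorphic_on_subset\<close>)
    hence "(\<lambda>k. a k * z ^ k) sums P z" by (simp add: a_def)
    moreover have "(\<lambda>k. a k * z ^ k) sums (\<Sum>k<N. a k * z ^ k)"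
      by (rule sums_finite) (use a0 in auto)
    ultimately show ?thesis
      by (simp add: sums_unique2 poly_sum poly_monom)
  qed
  thus ?thesis by blast
qed


section \<open>The hyperbolic cosine of an entire function, of finite order\<close>

lemma log_plus_nonneg: "log_plus x \<ge> 0"
  by (simp add: log_plus_def)

lemma log_plus_eq_ln_max: "x \<ge> 0 \<Longrightarrow> log_plus x = ln (max 1 x)"
  by (cases "x = 0") (auto simp: log_plus_def max_def ln_ge_zero_iff not_le)

lemma nevanlinna_char_entire:
  assumes "f holomorphic_on UNIV"
  shows "nevanlinna_char f r = proximity_fun f r"
proof -
  have "\<not> is_pole f z" for z
    using assms not_is_pole_holomorphic[of UNIV z f] by simp
  hence "pole_count f t = 0" for t by (simp add: pole_count_def)
  thus ?thesis by (simp add: nevanlinna_char_def integrated_pole_count_def)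
qed

lemma nevanlinna_char_le_powr_if_finite_order:
  assumes "growth_order f < \<infinity>"
  obtains K where "\<forall>\<^sub>F r in at_top. nevanlinna_char f r \<le> r powr K"
proof -
  obtain K where "growth_order f < ereal K"
    using assms less_PInf_Ex_of_nat ereal_dense2 by blast
  hence "\<forall>\<^sub>F r in at_top. ereal (ln (nevanlinna_char f r) / ln r) < ereal K"
    unfolding growth_order_def by (rule Limsup_lessD)
  hence "\<forall>\<^sub>F r in at_top. nevanlinna_char f r \<le> r powr K"
    using eventually_gt_at_top[of 1]
  proof eventually_elim
    case (elim r)
    show ?case
    proof (cases "nevanlinna_char f r > 0")
      case True
      have "ln (nevanlinna_char f r) \<le> K * ln r"
        using elim by (simp add: field_simps)
      hence "exp (ln (nevanlinna_char f r)) \<le> exp (K * ln r)" by simp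
      thus ?thesis using True elim by (simp add: powr_def)
    next
      case False
      \<comment> \<open>The logarithm of a non-positive value carries no information, but then the bound is trivial.\<close>
      thus ?thesis using powr_ge_zero[of r K] by linarith
    qed
  qed
  thus thesis by (rule that)
qed

text \<open>With \<open>x = \<bar>Re w\<bar>\<close>, the triangle inequality bounds \<open>cosh w\<close> from below by
  \<open>(exp x - exp (- x)) / 2\<close>, which is at least \<open>exp x / 4\<close> as soon as \<open>exp x \<ge> 4\<close>.\<close>

lemma abs_Re_le_log_plus_cosh:
  "\<bar>Re w\<bar> \<le> log_plus (norm ((exp w + exp (- w)) / 2)) + ln 4"
proof (cases "\<bar>Re w\<bar> \<le> ln 4")
  case True
  thus ?thesis using log_plus_nonneg[of "norm ((exp w + exp (- w)) / 2)"] by linarith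
next
  case False
  define x where "x = \<bar>Re w\<bar>"
  have "exp x > 4" using False ln_less_cancel_iff[of 4 "exp x"] by (simp add: x_def)
  have "exp (- x) \<le> 1" unfolding x_def by (subst exp_le_one_iff) simp
  have "exp x - exp (- x) = \<bar>norm (exp w) - norm (exp (- w))\<bar>"
    by (cases "Re w \<ge> 0") (auto simp: x_def)
  also have "\<dots> \<le> norm (exp w + exp (- w))"
    using norm_triangle_ineq3[of "exp w" "- exp (- w)"] by simp
  finally have "exp x / 4 \<le> norm ((exp w + exp (- w)) / 2)"
    using \<open>exp x > 4\<close> \<open>exp (- x) \<le> 1\<close> unfolding norm_divide norm_numeral by linarith
  hence "ln (exp x / 4) \<le> ln (norm ((exp w + exp (- w)) / 2))"
    by (subst ln_le_cancel_iff) (auto intro: less_le_trans[of 0 "exp x / 4"])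
  hence "x - ln 4 \<le> ln (norm ((exp w + exp (- w)) / 2))"
    by (simp add: ln_div)
  thus ?thesis by (simp add: x_def log_plus_def)
qed

lemma finite_order_cosh_imp_poly:
  assumes holo: "P holomorphic_on UNIV"
    and f: "\<And>z. f z = (exp (P z) + exp (- P z)) / 2"
    and order: "growth_order f < \<infinity>"
  shows "\<exists>p. \<forall>z. P z = poly p z"
proof -
  obtain K where K: "\<forall>\<^sub>F r in at_top. nevanlinna_char f r \<le> r powr K"
    using nevanlinna_char_le_powr_if_finite_order[OF order] by blast
  have holo_f: "f holomorphic_on UNIV"
    unfolding f[abs_def] by (intro holomorphic_intros holo) auto
  have cont: "continuous_on UNIV P" "continuous_on UNIV f"
    using holo holo_f holomorphic_on_imp_continuous_on by blast+
  have mean: "integral {0..2 * pi} (\<lambda>\<theta>. \<bar>Re (P (of_real r * cis \<theta>))\<bar>)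
      \<le> 2 * pi * nevanlinna_char f r + 2 * pi * ln 4" for r
  proof -
    let ?l = "\<lambda>\<theta>. log_plus (norm (f (of_real r * cis \<theta>)))"
    have int: "?l integrable_on {0..2 * pi}"
      unfolding log_plus_eq_ln_max[OF norm_ge_zero]
      by (intro integrable_continuous_real continuous_intros
            continuous_on_compose2[OF cont(2)]) auto
    have "integral {0..2 * pi} (\<lambda>\<theta>. \<bar>Re (P (of_real r * cis \<theta>))\<bar>)
        \<le> integral {0..2 * pi} (\<lambda>\<theta>. ?l \<theta> + ln 4)"
    proof (rule integral_le)
      show "(\<lambda>\<theta>. \<bar>Re (P (of_real r * cis \<theta>))\<bar>) integrable_on {0..2 * pi}"
        by (intro integrable_continuous_real continuous_intros
              continuous_on_compose2[OF cont(1)]) auto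
      show "(\<lambda>\<theta>. ?l \<theta> + ln 4) integrable_on {0..2 * pi}"
        by (intro integrable_add int) auto
    qed (simp only: f abs_Re_le_log_plus_cosh)
    also have "\<dots> = integral {0..2 * pi} ?l + 2 * pi * ln 4"
      by (subst integral_add) (use int in auto)
    also have "integral {0..2 * pi} ?l = 2 * pi * nevanlinna_char f r"
      by (simp add: nevanlinna_char_entire[OF holo_f] proximity_fun_def)
    finally show ?thesis .
  qed
  have "\<forall>\<^sub>F r in at_top. integral {0..2 * pi} (\<lambda>\<theta>. \<bar>Re (P (of_real r * cis \<theta>))\<bar>)
      \<le> 2 * pi * r powr K + 2 * pi * ln 4"
    using K
  proof eventually_elim
    case (elim r)
    hence "2 * pi * nevanlinna_char f r \<le> 2 * pi * r powr K" by simp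
    thus ?case using mean[of r] by linarith
  qed
  thus ?thesis by (rule entire_eq_poly_if_mean_abs_Re_le_powr[OF holo])
qed


section \<open>Solving the equation\<close>

lemma entire_sum_squares_eq_1:
  assumes "f holomorphic_on UNIV" "g holomorphic_on UNIV"
    and eq: "\<And>z. (f z)\<^sup>2 + (g z)\<^sup>2 = 1"
  obtains P where "P holomorphic_on UNIV"
    "\<And>z. f z = (exp (P z) + exp (- P z)) / 2"
    "\<And>z. 2 * \<i> * g z = exp (P z) - exp (- P z)"
proof -
  have prod: "(f z + \<i> * g z) * (f z - \<i> * g z) = 1" for z
    using eq[of z] by (simp add: algebra_simps power2_eq_square)
  have "(\<lambda>z. f z + \<i> * g z) holomorphic_on UNIV"
    by (intro holomorphic_intros assms)
  moreover have "f z + \<i> * g z \<noteq> 0" for z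
    using prod[of z] by auto
  ultimately obtain P where P: "P holomorphic_on UNIV" "\<And>z. f z + \<i> * g z = exp (P z)"
    by (rule contractible_imp_holomorphic_log[OF _ contractible_UNIV]) simp_all
  have minus: "f z - \<i> * g z = exp (- P z)" for z
    using prod[of z] by (simp add: P(2) exp_minus inverse_unique)
  show thesis
  proof (rule that[OF P(1)])
    show "f z = (exp (P z) + exp (- P z)) / 2" for z
      by (simp add: P(2)[symmetric] minus[symmetric])
    show "2 * \<i> * g z = exp (P z) - exp (- P z)" for z
      by (simp add: P(2)[symmetric] minus[symmetric])
  qed
qed

lemma higher_deriv_cosh_poly:
  "(deriv ^^ k) (\<lambda>z. (exp (poly p z) + exp (- poly p z)) / 2) z =
     (poly ((twisted_deriv p ^^ k) 1) z * exp (poly p z)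
      + poly ((twisted_deriv (- p) ^^ k) 1) z * exp (poly (- p) z)) / 2"
proof (induction k arbitrary: z)
  case (Suc k)
  have "((\<lambda>z. (poly ((twisted_deriv p ^^ k) 1) z * exp (poly p z)
      + poly ((twisted_deriv (- p) ^^ k) 1) z * exp (poly (- p) z)) / 2) has_field_derivative
      (poly ((twisted_deriv p ^^ Suc k) 1) z * exp (poly p z)
      + poly ((twisted_deriv (- p) ^^ Suc k) 1) z * exp (poly (- p) z)) / 2) (at z)"
    unfolding funpow.simps o_apply
    by (intro DERIV_cdivide DERIV_add DERIV_poly_times_exp_poly)
  thus ?case
    unfolding funpow.simps o_apply Suc.IH[abs_def] by (rule DERIV_imp_deriv)
qed simp

lemma completed_square_roots:
  fixes \<alpha> \<beta> w d :: complex
  assumes "\<alpha> \<noteq> 0" "(\<alpha> * w + \<beta>)\<^sup>2 = d"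
  shows "w = (- \<beta> + csqrt d) / \<alpha> \<or> w = (- \<beta> - csqrt d) / \<alpha>"
proof -
  have "(\<alpha> * w + \<beta>)\<^sup>2 = (csqrt d)\<^sup>2" using assms(2) by simp
  hence "\<alpha> * w + \<beta> = csqrt d \<or> \<alpha> * w + \<beta> = - csqrt d"
    by (simp only: power2_eq_iff)
  hence "\<alpha> * w = csqrt d - \<beta> \<or> \<alpha> * w = - csqrt d - \<beta>"
    by (simp only: eq_diff_eq)
  thus ?thesis using assms(1) by (simp add: eq_divide_eq mult.commute minus_diff_commute)
qed

lemma powi_diff_eq_divide_iff:
  fixes a A B x :: complex
  assumes "a \<noteq> 0" "A \<noteq> 0"
  shows "a powi (int m - int n) = x * (B / A) \<longleftrightarrow> a ^ m * A = x * (a ^ n * B)"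
proof -
  have "a powi (int m - int n) = a ^ m / a ^ n"
    using assms by (simp add: power_int_diff)
  also have "\<dots> = x * (B / A) \<longleftrightarrow> a ^ m * A = x * (a ^ n * B)"
    using assms by (simp add: frac_eq_eq mult_ac)
  finally show ?thesis .
qed

theorem theorem2p2:
  fixes m n :: nat and c A B :: complex and R :: "complex poly" and f :: "complex \<Rightarrow> complex"
  assumes "m > 0" and "n > 0" and "c \<noteq> 0" and "A \<noteq> 0" and "B \<noteq> 0" and "R \<noteq> 0"
    and "transcendental_entire f"
    and "growth_order f < \<infinity>"
    and "\<And>z. (f z)\<^sup>2 + (poly R z)\<^sup>2 * (A * (deriv ^^ m) f (z + c) + B * (deriv ^^ n) f z)\<^sup>2 = 1"
  shows "\<exists>R0. R = [:R0:] \<and> (\<exists>a b.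
    (\<forall>z. f z = (exp (a * z + b) + exp (- (a * z + b))) / 2) \<and>
    (even m \<and> even n \<longrightarrow>
       a powi (int m - int n) \<noteq> B / A \<and> a powi (int m - int n) \<noteq> - (B / A) \<and>
       R0\<^sup>2 = 1 / (a ^ (2 * m) * A\<^sup>2 - a ^ (2 * n) * B\<^sup>2) \<and>
       (exp (a * c) = (- (a ^ n * B) + csqrt ((a ^ n * B)\<^sup>2 - (a ^ m * A)\<^sup>2)) / (a ^ m * A) \<or>
        exp (a * c) = (- (a ^ n * B) - csqrt ((a ^ n * B)\<^sup>2 - (a ^ m * A)\<^sup>2)) / (a ^ m * A)) \<and>
       exp (a * c) \<notin> {1, - 1, - ((a ^ m * A) / (a ^ n * B)), - ((a ^ n * B) / (a ^ m * A))}) \<and>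
    (odd m \<and> odd n \<longrightarrow>
       (exp (a * c) = 1 \<and> a powi (int m - int n) \<noteq> - (B / A) \<and>
          R0 = - \<i> / (a ^ n * B + a ^ m * A)) \<or>
       (exp (a * c) = - 1 \<and> a powi (int m - int n) \<noteq> B / A \<and>
          R0 = - \<i> / (a ^ n * B - a ^ m * A))) \<and>
    (even m \<and> odd n \<longrightarrow>
       (exp (a * c) = \<i> \<and> a powi (int m - int n) \<noteq> \<i> * (B / A) \<and>
          R0 = - \<i> / (a ^ n * B + \<i> * a ^ m * A)) \<or>
       (exp (a * c) = - \<i> \<and> a powi (int m - int n) \<noteq> - \<i> * (B / A) \<and>
          R0 = - \<i> / (a ^ n * B - \<i> * a ^ m * A))) \<and>
    (odd m \<and> even n \<longrightarrow>
       a powi (int m - int n) \<noteq> \<i> * (B / A) \<and> a powi (int m - int n) \<noteq> - \<i> * (B / A) \<and>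
       R0\<^sup>2 = - (1 / (a ^ (2 * n) * B\<^sup>2 + a ^ (2 * m) * A\<^sup>2)) \<and>
       (exp (a * c) = (- (a ^ n * B) + csqrt ((a ^ n * B)\<^sup>2 + (a ^ m * A)\<^sup>2)) / (a ^ m * A) \<or>
        exp (a * c) = (- (a ^ n * B) - csqrt ((a ^ n * B)\<^sup>2 + (a ^ m * A)\<^sup>2)) / (a ^ m * A)) \<and>
       exp (a * c) \<notin> {1, - 1, (a ^ m * A) / (a ^ n * B), - ((a ^ n * B) / (a ^ m * A))}))"
proof -
  define g where "g z = poly R z * (A * (deriv ^^ m) f (z + c) + B * (deriv ^^ n) f z)" for z
  have holo_f: "f holomorphic_on UNIV"
    using assms(7) by (simp add: transcendental_entire_def)
  have "(\<lambda>z. (deriv ^^ m) f (z + c)) holomorphic_on UNIV"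
    using holomorphic_on_compose_gen[of "\<lambda>z. z + c" UNIV "(deriv ^^ m) f" UNIV]
      holomorphic_higher_deriv[OF holo_f open_UNIV, of m]
    by (simp add: o_def holomorphic_intros)
  hence holo_g: "g holomorphic_on UNIV"
    unfolding g_def[abs_def] by (intro holomorphic_intros holo_f) auto
  have "(f z)\<^sup>2 + (g z)\<^sup>2 = 1" for z
    using assms(9)[of z] by (simp add: g_def power_mult_distrib)
  then obtain P0 where P0: "P0 holomorphic_on UNIV"
    "\<And>z. f z = (exp (P0 z) + exp (- P0 z)) / 2"
    "\<And>z. 2 * \<i> * g z = exp (P0 z) - exp (- P0 z)"
    using entire_sum_squares_eq_1[OF holo_f holo_g] by blast
  obtain P where P: "\<And>z. P0 z = poly P z"
    using finite_order_cosh_imp_poly[OF P0(1,2) assms(8)] by blast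
  have f: "f = (\<lambda>z. (exp (poly P z) + exp (- poly P z)) / 2)"
    using P0(2) P by auto

  have degP: "degree P \<noteq> 0"
  proof
    assume "degree P = 0"
    then obtain b where "P = [:b:]" by (meson degree_eq_zeroE)
    hence "\<forall>z. f z = poly [:(exp b + exp (- b)) / 2:] z" by (simp add: f)
    thus False using assms(7) unfolding transcendental_entire_def by blast
  qed
  hence dP: "pderiv P \<noteq> 0" by (simp add: pderiv_eq_0_iff)

  \<comment> \<open>The \<open>k\<close>-th derivative of \<open>f\<close> is \<open>(H\<^sub>k exp P + G\<^sub>k exp (- P)) / 2\<close>; precomposition with \<open>s\<close> is
    the shift by \<open>c\<close>.\<close>
  define H where "H k = (twisted_deriv P ^^ k) 1" for k
  define G where "G k = (twisted_deriv (- P) ^^ k) 1" for k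
  define s where "s = [:c, 1:]"
  define Pc where "Pc = P \<circ>\<^sub>p s"
  have s: "poly (q \<circ>\<^sub>p s) z = poly q (z + c)" for q z
    by (simp add: s_def poly_pcompose add.commute)
  have main: "poly (R * smult A (H m \<circ>\<^sub>p s)) z * exp (poly Pc z)
      + poly (R * smult A (G m \<circ>\<^sub>p s)) z * exp (poly (- Pc) z)
      + poly (R * smult B (H n) + [:\<i>:]) z * exp (poly P z)
      + poly (R * smult B (G n) - [:\<i>:]) z * exp (poly (- P) z) = 0" for z
  proof -
    have "2 * g z = - \<i> * (2 * \<i> * g z)" by simp
    also have "\<dots> = - \<i> * (exp (poly P z) - exp (- poly P z))"
      by (simp only: P0(3) P)
    finally have "2 * g z + \<i> * exp (poly P z) - \<i> * exp (- poly P z) = 0"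
      by (simp add: algebra_simps)
    moreover have D: "(deriv ^^ k) f z = (poly (H k) z * exp (poly P z)
        + poly (G k) z * exp (poly (- P) z)) / 2" for k z
      unfolding f H_def G_def by (rule higher_deriv_cosh_poly)
    hence "2 * g z = poly R z * (A * (poly (H m) (z + c) * exp (poly P (z + c))
        + poly (G m) (z + c) * exp (poly (- P) (z + c)))
      + B * (poly (H n) z * exp (poly P z) + poly (G n) z * exp (poly (- P) z)))"
      unfolding g_def D by (simp add: algebra_simps flip: add_divide_distrib)
    ultimately show ?thesis
      by (simp add: s Pc_def algebra_simps)
  qed

  have "degree P = 1"
  proof (rule ccontr)
    assume "degree P \<noteq> 1"
    hence deg: "degree (pderiv P) \<noteq> 0" using degP by (simp add: degree_pderiv)
    define p where "p i = [R * smult A (H m \<circ>\<^sub>p s), R * smult A (G m \<circ>\<^sub>p s),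
      R * smult B (H n) + [:\<i>:], R * smult B (G n) - [:\<i>:]] ! i" for i
    define Q where "Q i = [Pc, - Pc, P, - P] ! i" for i
    have dPc: "pderiv Pc = pderiv P \<circ>\<^sub>p s"
      by (simp add: Pc_def s_def pderiv_pcompose pderiv_pCons)
    \<comment> \<open>No two of the exponents \<open>P(z + c), - P(z + c), P(z), - P(z)\<close> differ by a constant: a
      polynomial derivative of positive degree is not periodic, and shifting keeps the leading
      coefficient, hence does not change the sign.\<close>
    have ne: "pderiv P \<circ>\<^sub>p s \<noteq> pderiv P"
      using poly_periodic_imp_degree_0[of "pderiv P" c] deg assms(3) by (auto simp: s_def)
    have ne': "pderiv P \<circ>\<^sub>p s \<noteq> - pderiv P"
    proof
      assume "pderiv P \<circ>\<^sub>p s = - pderiv P"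
      hence "lead_coeff (pderiv P \<circ>\<^sub>p s) = lead_coeff (- pderiv P)" by simp
      moreover have "lead_coeff (pderiv P \<circ>\<^sub>p s) = lead_coeff (pderiv P)"
        by (subst lead_coeff_comp) (simp_all add: s_def)
      ultimately show False using dP by simp
    qed
    have ne0: "pderiv P \<circ>\<^sub>p s \<noteq> 0"
      using dP by (simp add: pcompose_eq_0_iff s_def)
    have self_neg: "q \<noteq> - q" if "q \<noteq> 0" for q :: "complex poly"
      using that by (auto simp: poly_eq_iff)
    have distinct: "distinct (map pderiv [Pc, - Pc, P, - P])"
      using ne ne' self_neg[OF dP] self_neg[OF ne0] ne'[THEN not_sym]
      by (simp add: dPc pderiv_minus minus_equation_iff[of "pderiv P \<circ>\<^sub>p s" "pderiv P"])
    have "p 0 = 0"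
    proof (rule exp_poly_linear_independent[of "{..<4}" Q])
      show "pderiv (Q i - Q j) \<noteq> 0" if "i \<in> {..<4}" "j \<in> {..<4}" "i \<noteq> j" for i j
      proof -
        have Q: "pderiv (Q i) = map pderiv [Pc, - Pc, P, - P] ! i" if "i < 4" for i
          unfolding Q_def using that by (subst nth_map) simp_all
        have "map pderiv [Pc, - Pc, P, - P] ! i \<noteq> map pderiv [Pc, - Pc, P, - P] ! j"
          by (subst nth_eq_iff_index_eq[OF distinct]) (use that in auto)
        thus ?thesis
          unfolding pderiv_diff right_minus_eq using Q that by (simp only: lessThan_iff not_False_eq_True)
      qed
      show "(\<Sum>i<4. poly (p i) z * exp (poly (Q i) z)) = 0" for z
        using main[of z] by (simp add: p_def Q_def eval_nat_numeral lessThan_Suc add_ac)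
    qed auto
    hence "H m = 0"
      using assms(4,6) by (simp add: p_def s_def pcompose_eq_0_iff)
    thus False using dP by (simp add: H_def funpow_twisted_deriv_eq_0_iff)
  qed

  then obtain b a where Pab: "P = [:b, a:]" and "a \<noteq> 0"
    by (cases P) (auto simp: degree_pCons_eq_if split: if_splits elim: degree_eq_zeroE)
  define w where "w = exp (a * c)"
  define \<alpha> where "\<alpha> = a ^ m * A"
  define \<beta> where "\<beta> = a ^ n * B"
  have nz: "\<alpha> \<noteq> 0" "\<beta> \<noteq> 0" "w \<noteq> 0"
    using \<open>a \<noteq> 0\<close> assms(4,5) by (auto simp: \<alpha>_def \<beta>_def w_def)
  have HG: "H k = [:a ^ k:]" "G k = [:(- a) ^ k:]" for k
    unfolding H_def G_def
    by (rule funpow_twisted_deriv_const, simp add: Pab pderiv_pCons)+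
  \<comment> \<open>The shifted exponentials are now multiples of \<open>exp P\<close> and \<open>exp (- P)\<close>, and only these two
    remain.\<close>
  define p where "p i = [smult (\<alpha> * w + \<beta>) R + [:\<i>:],
    smult ((- 1) ^ m * \<alpha> / w + (- 1) ^ n * \<beta>) R - [:\<i>:]] ! i" for i
  have p0: "p i = 0" if "i < 2" for i
  proof (rule exp_poly_linear_independent[of "{..<2}" "\<lambda>i. [P, - P] ! i"])
    show "pderiv ([P, - P] ! i - [P, - P] ! j) \<noteq> 0" if "i \<in> {..<2}" "j \<in> {..<2}" "i \<noteq> j" for i j
      using that \<open>a \<noteq> 0\<close> by (auto simp: less_2_cases_iff Pab pderiv_pCons)
    show "(\<Sum>i<2. poly (p i) z * exp (poly ([P, - P] ! i) z)) = 0" for z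
    proof -
      have "exp (poly Pc z) = w * exp (poly P z)" "exp (poly (- Pc) z) = exp (poly (- P) z) / w"
        by (simp_all add: Pc_def s Pab w_def algebra_simps exp_add exp_minus exp_diff divide_inverse)
      thus ?thesis
        using main[of z]
        by (simp add: HG p_def lessThan_Suc numeral_2_eq_2 \<alpha>_def \<beta>_def power_minus[of a] algebra_simps)
    qed
  qed (use that in auto)
  have R1: "smult (\<alpha> * w + \<beta>) R = [:- \<i>:]"
    using p0[of 0] by (simp add: p_def add_eq_0_iff2)
  have R2: "smult ((- 1) ^ m * \<alpha> / w + (- 1) ^ n * \<beta>) R = [:\<i>:]"
    using p0[of 1] by (simp add: p_def)
  have nz1: "\<alpha> * w + \<beta> \<noteq> 0" using R1 by auto
  have "degree R = 0"
    using arg_cong[OF R1, of degree] nz1 by simp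
  then obtain R0 where R0: "R = [:R0:]" by (meson degree_eq_zeroE)
  have e1: "(\<alpha> * w + \<beta>) * R0 = - \<i>" and e2: "((- 1) ^ m * \<alpha> / w + (- 1) ^ n * \<beta>) * R0 = \<i>"
    using R1 R2 by (simp_all add: R0)
  have R0_eq: "R0 = - \<i> / (\<beta> + \<alpha> * w)"
    using e1 nz1 by (simp add: field_simps)
  \<comment> \<open>Eliminating \<open>R0\<close> leaves a quadratic equation for \<open>w\<close>, whose shape depends on the parities.\<close>
  have e2': "((- 1) ^ m * \<alpha> + (- 1) ^ n * \<beta> * w) * R0 = \<i> * w"
    using e2 nz by (simp add: field_simps)
  have rel_R0: "((- 1) ^ m * \<alpha> + (- 1) ^ n * \<beta> * w) * R0 = - (w * (\<alpha> * w + \<beta>)) * R0"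
    unfolding e2' using e1 by (simp add: mult.assoc)
  have "R0 \<noteq> 0" using assms(6) R0 by auto
  have rel: "(- 1) ^ m * \<alpha> + (- 1) ^ n * \<beta> * w = - (w * (\<alpha> * w + \<beta>))"
    using rel_R0 unfolding mult_right_cancel[OF \<open>R0 \<noteq> 0\<close>] .
  have R0_sq: "R0\<^sup>2 = - 1 / (\<alpha> * w + \<beta>)\<^sup>2"
    unfolding R0_eq by (simp add: power_divide add.commute)
  note powi = powi_diff_eq_divide_iff[OF \<open>a \<noteq> 0\<close> assms(4), of m n _ B, folded \<alpha>_def \<beta>_def]
  have powi1: "a powi (int m - int n) = B / A \<longleftrightarrow> \<alpha> = \<beta>"
    "a powi (int m - int n) = - (B / A) \<longleftrightarrow> \<alpha> = - \<beta>"
    using powi[of 1] powi[of "- 1"] by simp_all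

  have squares: "a ^ (2 * m) * A\<^sup>2 = \<alpha>\<^sup>2" "a ^ (2 * n) * B\<^sup>2 = \<beta>\<^sup>2"
    by (simp_all add: \<alpha>_def \<beta>_def power_mult_distrib mult.commute flip: power_mult)

  have I: "a powi (int m - int n) \<noteq> B / A \<and> a powi (int m - int n) \<noteq> - (B / A) \<and>
       R0\<^sup>2 = 1 / (a ^ (2 * m) * A\<^sup>2 - a ^ (2 * n) * B\<^sup>2) \<and>
       (w = (- \<beta> + csqrt (\<beta>\<^sup>2 - \<alpha>\<^sup>2)) / \<alpha> \<or> w = (- \<beta> - csqrt (\<beta>\<^sup>2 - \<alpha>\<^sup>2)) / \<alpha>) \<and>
       w \<notin> {1, - 1, - (\<alpha> / \<beta>), - (\<beta> / \<alpha>)}" if "even m" "even n"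
  proof -
    have rel': "\<alpha> + \<beta> * w = - (w * (\<alpha> * w + \<beta>))"
      using rel that by simp
    have q: "\<alpha> * w\<^sup>2 + 2 * \<beta> * w + \<alpha> = 0"
      using rel' by algebra
    hence sq: "(\<alpha> * w + \<beta>)\<^sup>2 = \<beta>\<^sup>2 - \<alpha>\<^sup>2" by algebra
    have ne: "\<alpha>\<^sup>2 \<noteq> \<beta>\<^sup>2" using sq nz1 by auto
    have "R0\<^sup>2 = 1 / (\<alpha>\<^sup>2 - \<beta>\<^sup>2)"
      using R0_sq sq by (metis minus_diff_eq minus_divide_divide)
    moreover have "w \<noteq> 1" "w \<noteq> - 1"
      using q ne by (auto simp: power2_eq_iff) algebra+
    moreover have "w \<noteq> - (\<beta> / \<alpha>)" using nz1 nz by auto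
    \<comment> \<open>The coefficient of \<open>exp (- P)\<close> must not vanish either.\<close>
    moreover have "\<alpha> + \<beta> * w \<noteq> 0" using e2' that nz by auto
    hence "w \<noteq> - (\<alpha> / \<beta>)" using nz by auto
    moreover have "\<alpha> \<noteq> \<beta>" "\<alpha> \<noteq> - \<beta>" using ne by auto
    ultimately show ?thesis
      using completed_square_roots[OF nz(1) sq] unfolding powi1 squares by blast
  qed

  have IV: "a powi (int m - int n) \<noteq> \<i> * (B / A) \<and> a powi (int m - int n) \<noteq> - \<i> * (B / A) \<and>
       R0\<^sup>2 = - (1 / (a ^ (2 * n) * B\<^sup>2 + a ^ (2 * m) * A\<^sup>2)) \<and>
       (w = (- \<beta> + csqrt (\<beta>\<^sup>2 + \<alpha>\<^sup>2)) / \<alpha> \<or> w = (- \<beta> - csqrt (\<beta>\<^sup>2 + \<alpha>\<^sup>2)) / \<alpha>) \<and>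
       w \<notin> {1, - 1, \<alpha> / \<beta>, - (\<beta> / \<alpha>)}" if "odd m" "even n"
  proof -
    have rel': "- \<alpha> + \<beta> * w = - (w * (\<alpha> * w + \<beta>))"
      using rel that by simp
    have q: "\<alpha> * w\<^sup>2 + 2 * \<beta> * w - \<alpha> = 0"
      using rel' by algebra
    hence sq: "(\<alpha> * w + \<beta>)\<^sup>2 = \<beta>\<^sup>2 + \<alpha>\<^sup>2" by algebra
    have ne: "\<beta>\<^sup>2 + \<alpha>\<^sup>2 \<noteq> 0" using sq nz1 by auto
    have "R0\<^sup>2 = - (1 / (\<beta>\<^sup>2 + \<alpha>\<^sup>2))"
      using R0_sq sq by simp
    moreover have "w \<noteq> 1" "w \<noteq> - 1" using q nz by auto
    moreover have "w \<noteq> - (\<beta> / \<alpha>)" using nz1 nz by auto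
    moreover have "- \<alpha> + \<beta> * w \<noteq> 0" using e2' that nz by auto
    hence "w \<noteq> \<alpha> / \<beta>" using nz by auto
    moreover have "\<alpha> \<noteq> \<i> * \<beta>" "\<alpha> \<noteq> - \<i> * \<beta>"
      using ne by (auto simp: power_mult_distrib)
    ultimately show ?thesis
      using completed_square_roots[OF nz(1) sq] unfolding powi squares by blast
  qed

  have II: "(w = 1 \<and> a powi (int m - int n) \<noteq> - (B / A) \<and> R0 = - \<i> / (\<beta> + \<alpha>)) \<or>
       (w = - 1 \<and> a powi (int m - int n) \<noteq> B / A \<and> R0 = - \<i> / (\<beta> - \<alpha>))" if "odd m" "odd n"
  proof -
    have rel': "- \<alpha> - \<beta> * w = - (w * (\<alpha> * w + \<beta>))"
      using rel that by simp
    have "\<alpha> * (w\<^sup>2 - 1) = 0"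
      using rel' by algebra
    hence "w = 1 \<or> w = - 1" using nz by (simp add: power2_eq_1_iff)
    thus ?thesis using nz1 R0_eq unfolding powi1 by auto
  qed

  have III: "(w = \<i> \<and> a powi (int m - int n) \<noteq> \<i> * (B / A) \<and>
          R0 = - \<i> / (a ^ n * B + \<i> * a ^ m * A)) \<or>
       (w = - \<i> \<and> a powi (int m - int n) \<noteq> - \<i> * (B / A) \<and>
          R0 = - \<i> / (a ^ n * B - \<i> * a ^ m * A))" if "even m" "odd n"
  proof -
    have rel': "\<alpha> - \<beta> * w = - (w * (\<alpha> * w + \<beta>))"
      using rel that by simp
    have "\<alpha> * (w\<^sup>2 + 1) = 0"
      using rel' by algebra
    hence "w\<^sup>2 + 1 = 0" using nz by simp
    hence "(w - \<i>) * (w + \<i>) = 0" by (simp add: algebra_simps power2_eq_square)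
    hence "w = \<i> \<or> w = - \<i>" by (auto simp: eq_neg_iff_add_eq_0)
    moreover have "\<alpha> \<noteq> w * \<beta>" if "w\<^sup>2 = - 1"
      using nz1 that by (auto simp: power2_eq_square algebra_simps)
    ultimately show ?thesis using R0_eq unfolding powi
      by (auto simp: \<alpha>_def \<beta>_def mult_ac)
  qed

  have fz: "\<forall>z. f z = (exp (a * z + b) + exp (- (a * z + b))) / 2"
    by (simp add: f Pab algebra_simps)
  note cases = I[unfolded w_def \<alpha>_def \<beta>_def] II[unfolded w_def \<alpha>_def \<beta>_def]
    III[unfolded w_def \<alpha>_def \<beta>_def] IV[unfolded w_def \<alpha>_def \<beta>_def]
  show ?thesis
    by (rule exI[of _ R0], rule conjI[OF R0], rule exI[of _ a], rule exI[of _ b],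
        rule conjI[OF fz], intro conjI; rule impI, erule conjE, rule cases; assumption)
qed

end
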